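(* Let $(S_n)_{n\geq 0}$ be the one-dimensional elephant random walk with first step parameter $q=\frac12$ and memory parameter $p=\frac14$ (equivalently $a=2p-1=-\frac12$). For all $n\geq 1$ and all integers $k$ with $-n\leq k\leq n$ such that $k$ and $n$ have the same parity, $$\mathbb{P}(S_n=k)=\frac{1}{2^{2n-1}}\binom{2n}{n+k}.$$ In particular, for any $n\geq 1$, $$\mathbb{P}(S_{2n}=0)=\frac{1}{2^{4n-1}}\binom{4n}{2n},$$ and, as $n\to\infty$, $\mathbb{P}(S_{2n}=0)\sim\sqrt{\frac{2}{\pi n}}$.
   Context: The one-dimensional elephant random walk $(S_n)_{n\geq 0}$ with first step parameter $q\in[0,1]$ and memory parameter $p\in[0,1]$ is defined as follows. $S_0=0$. The first step $X_1$ equals $+1$ with probability $q$ and $-1$ with probability $1-q$, and $S_1=X_1$. For each $n\geq 1$, given the past steps $X_1,\dots,X_n$, an integer $k$ is chosen uniformly at random in $\{1,\dots,n\}$ (independently of the past), and then, independently, $X_{n+1}=X_k$ with probability $p$ and $X_{n+1}=-X_k$ with probability $1-p$; one sets $S_{n+1}=S_n+X_{n+1}$. Here $u_n\sim v_n$ means $u_n/v_n\to1$. *)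

theory Defs
  imports "HOL-Probability.Probability"
begin

(* The library's indep_var requires both random variables to have the same codomain type. *)
definition (in prob_space) indep_rv ::
  "'b measure \<Rightarrow> ('a \<Rightarrow> 'b) \<Rightarrow> 'c measure \<Rightarrow> ('a \<Rightarrow> 'c) \<Rightarrow> bool" where
  "indep_rv N Y N' Z \<longleftrightarrow>
     random_variable N Y \<and> random_variable N' Z \<and>
     indep_set (sets (vimage_algebra (space M) Y N)) (sets (vimage_algebra (space M) Z N'))"

(* X n, K n and B n are meaningful for n \<ge> 1 only: K n is the index recalled when the (n+1)-st
   step is made, and B n says whether the recalled step is repeated (True) or reversed (False).
   Independence is required at each time only in the sequential form
   "K n independent of the past, then B n independent of the past and of K n",
   where the past is the vector of steps (X 1, ..., X n). *)
locale elephant_random_walk = prob_space M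
  for M :: "'a measure" and q p :: real
    and X :: "nat \<Rightarrow> 'a \<Rightarrow> int" and K :: "nat \<Rightarrow> 'a \<Rightarrow> nat" and B :: "nat \<Rightarrow> 'a \<Rightarrow> bool"
    and S :: "nat \<Rightarrow> 'a \<Rightarrow> int" +
  assumes q_range: "q \<in> {0..1}"
    and p_range: "p \<in> {0..1}"
    and X_measurable: "\<And>n. n \<ge> 1 \<Longrightarrow> random_variable (count_space UNIV) (X n)"
    and K_measurable: "\<And>n. n \<ge> 1 \<Longrightarrow> random_variable (count_space {1..n}) (K n)"
    and B_measurable: "\<And>n. n \<ge> 1 \<Longrightarrow> random_variable (count_space UNIV) (B n)"
    and first_step_pos: "prob {\<omega> \<in> space M. X 1 \<omega> = 1} = q"
    and first_step_neg: "prob {\<omega> \<in> space M. X 1 \<omega> = - 1} = 1 - q"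
    and K_uniform:
      "\<And>n. n \<ge> 1 \<Longrightarrow> distr M (count_space {1..n}) (K n) = uniform_count_measure {1..n}"
    and B_bernoulli: "\<And>n. n \<ge> 1 \<Longrightarrow> prob {\<omega> \<in> space M. B n \<omega>} = p"
    and K_indep_past:
      "\<And>n. n \<ge> 1 \<Longrightarrow>
        indep_rv (\<Pi>\<^sub>M i\<in>{1..n}. count_space UNIV) (\<lambda>\<omega>. \<lambda>i\<in>{1..n}. X i \<omega>)
                  (count_space {1..n}) (K n)"
    and B_indep_past_K:
      "\<And>n. n \<ge> 1 \<Longrightarrow>
        indep_rv ((\<Pi>\<^sub>M i\<in>{1..n}. count_space UNIV) \<Otimes>\<^sub>M count_space {1..n})
                  (\<lambda>\<omega>. (\<lambda>i\<in>{1..n}. X i \<omega>, K n \<omega>))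
                  (count_space UNIV) (B n)"
    and step:
      "\<And>n \<omega>. n \<ge> 1 \<Longrightarrow> \<omega> \<in> space M \<Longrightarrow>
        X (n + 1) \<omega> = (if B n \<omega> then X (K n \<omega>) \<omega> else - X (K n \<omega>) \<omega>)"
    and S_0: "\<And>\<omega>. \<omega> \<in> space M \<Longrightarrow> S 0 \<omega> = 0"
    and S_Suc: "\<And>n \<omega>. \<omega> \<in> space M \<Longrightarrow> S (n + 1) \<omega> = S n \<omega> + X (n + 1) \<omega>"

end

theory Submission
  imports Defs "HOL-Real_Asymp.Real_Asymp"
begin

text \<open>Given the first \<open>n\<close> steps, all of which are \<open>\<plusminus>1\<close> almost surely, the proportion of steps equal
  to \<open>e \<in> {1, -1}\<close> is \<open>(1 + e S\<^sub>n / n) / 2\<close>. Hence \<open>S\<close> is a Markov chain which moves by \<open>e\<close> with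
  probability \<open>(1 + (2p - 1) e S\<^sub>n / n) / 2\<close>. For \<open>p = 1/4\<close>, Pascal's rule and the absorption
  identities for binomial coefficients show that the claimed law solves the resulting recursion. The
  asymptotics of the central binomial coefficient come from Gauss's limit formula for
  \<open>\<Gamma>(1/2) = \<surd>\<pi>\<close>.\<close>

section \<open>Independence and the law of the next step jointly with the past\<close>

lemma (in prob_space) indep_rv_prob_Int:
  assumes "indep_rv N Y N' Z" and A: "A \<in> sets N" and C: "C \<in> sets N'"
  shows "prob {\<omega> \<in> space M. Y \<omega> \<in> A \<and> Z \<omega> \<in> C}
    = prob {\<omega> \<in> space M. Y \<omega> \<in> A} * prob {\<omega> \<in> space M. Z \<omega> \<in> C}"
proof -
  have "prob ((Y -` A \<inter> space M) \<inter> (Z -` C \<inter> space M))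
      = prob (Y -` A \<inter> space M) * prob (Z -` C \<inter> space M)"
    using assms(1) unfolding indep_rv_def
    by (intro indep_setD) (auto intro: in_vimage_algebra A C)
  moreover have "(Y -` A \<inter> space M) \<inter> (Z -` C \<inter> space M) = {\<omega> \<in> space M. Y \<omega> \<in> A \<and> Z \<omega> \<in> C}"
    "Y -` A \<inter> space M = {\<omega> \<in> space M. Y \<omega> \<in> A}" "Z -` C \<inter> space M = {\<omega> \<in> space M. Z \<omega> \<in> C}"
    by auto
  ultimately show ?thesis by simp
qed

context elephant_random_walk
begin

lemma K_range:
  assumes "n \<ge> 1" "\<omega> \<in> space M" shows "K n \<omega> \<in> {1..n}"
  using measurable_space[OF K_measurable[OF assms(1)] assms(2)] by simp

text \<open>A finite vector of integers has only countably many values, so the product sigma-algebra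
  is discrete. Hence any predicate \<open>P\<close> on the past defines an event, and the lemmas
  below can quantify over \<open>P\<close> freely.\<close>

lemma PiM_past_eq:
  "(\<Pi>\<^sub>M i\<in>{1..n}. count_space (UNIV :: int set)) = count_space ({1..n} \<rightarrow>\<^sub>E UNIV)" for n :: nat
  by (rule count_space_PiM_finite) auto

lemma PiM_past_K_eq:
  "(\<Pi>\<^sub>M i\<in>{1..n}. count_space (UNIV :: int set)) \<Otimes>\<^sub>M count_space {1..n}
    = count_space (({1..n} \<rightarrow>\<^sub>E UNIV) \<times> {1..n})" for n :: nat
  unfolding PiM_past_eq by (rule pair_measure_countable) (auto intro: countable_PiE)

lemma prob_K:
  assumes n: "n \<ge> 1" and j: "j \<in> {1..n}"
  shows "prob {\<omega> \<in> space M. K n \<omega> = j} = 1 / n"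
proof -
  have "{\<omega> \<in> space M. K n \<omega> = j} = K n -` {j} \<inter> space M" by auto
  hence "prob {\<omega> \<in> space M. K n \<omega> = j} = measure (distr M (count_space {1..n}) (K n)) {j}"
    using j by (subst measure_distr[OF K_measurable[OF n]]) auto
  also have "\<dots> = 1 / n"
    using j unfolding K_uniform[OF n] by (subst measure_uniform_count_measure) auto
  finally show ?thesis .
qed

lemma B_event: "n \<ge> 1 \<Longrightarrow> {\<omega> \<in> space M. B n \<omega>} \<in> events"
  using B_measurable by (rule measurable_sets_Collect) auto

lemma prob_B:
  assumes n: "n \<ge> 1"
  shows "prob {\<omega> \<in> space M. B n \<omega> = b} = (if b then p else 1 - p)"
proof (cases b)
  case True
  then show ?thesis using B_bernoulli[OF n] by simp
next
  case False
  then show ?thesis using B_bernoulli[OF n] prob_neg[OF B_event[OF n]] by simp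
qed

text \<open>The product rule is used twice, following the sequential form of independence:
  \<open>B n\<close> splits off from the pair (past, \<open>K n\<close>), then \<open>K n\<close>
  splits off from the past. The predicate \<open>P\<close> is arbitrary so that it may later mention
  the \<open>j\<close>-th step itself.\<close>

lemma prob_past_K_B:
  assumes n: "n \<ge> 1" and j: "j \<in> {1..n}"
  shows "prob {\<omega> \<in> space M. P (\<lambda>i\<in>{1..n}. X i \<omega>) \<and> K n \<omega> = j \<and> B n \<omega> = b}
    = prob {\<omega> \<in> space M. P (\<lambda>i\<in>{1..n}. X i \<omega>)} / n * (if b then p else 1 - p)"
proof -
  define V where "V = {v \<in> {1..n} \<rightarrow>\<^sub>E UNIV. P v}"
  have V: "(\<lambda>i\<in>{1..n}. X i \<omega>) \<in> V \<longleftrightarrow> P (\<lambda>i\<in>{1..n}. X i \<omega>)" for \<omega>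
    by (auto simp: V_def)
  have 1: "prob {\<omega> \<in> space M. (\<lambda>i\<in>{1..n}. X i \<omega>) \<in> V \<and> K n \<omega> \<in> {j}}
      = prob {\<omega> \<in> space M. (\<lambda>i\<in>{1..n}. X i \<omega>) \<in> V} * prob {\<omega> \<in> space M. K n \<omega> \<in> {j}}"
    using j by (intro indep_rv_prob_Int[OF K_indep_past[OF n]])
      (auto simp: PiM_past_eq V_def simp del: One_nat_def)
  have VK: "V \<times> {j} \<in> sets ((\<Pi>\<^sub>M i\<in>{1..n}. count_space UNIV) \<Otimes>\<^sub>M count_space {1..n})"
    unfolding PiM_past_K_eq using j by (auto simp: V_def)
  have 2: "prob {\<omega> \<in> space M. (\<lambda>i\<in>{1..n}. X i \<omega>, K n \<omega>) \<in> V \<times> {j} \<and> B n \<omega> \<in> {b}}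
      = prob {\<omega> \<in> space M. (\<lambda>i\<in>{1..n}. X i \<omega>, K n \<omega>) \<in> V \<times> {j}} * prob {\<omega> \<in> space M. B n \<omega> \<in> {b}}"
    by (rule indep_rv_prob_Int[OF B_indep_past_K[OF n] VK]) simp
  show ?thesis
    using 1 2 prob_K[OF n j] prob_B[OF n, of b]
    by (simp add: V del: One_nat_def)
qed

lemma past_event:
  assumes n: "n \<ge> 1"
  shows "{\<omega> \<in> space M. P (\<lambda>i\<in>{1..n}. X i \<omega>)} \<in> events"
proof -
  have m: "random_variable (count_space ({1..n} \<rightarrow>\<^sub>E UNIV)) (\<lambda>\<omega>. \<lambda>i\<in>{1..n}. X i \<omega>)"
    using K_indep_past[OF n] unfolding indep_rv_def PiM_past_eq by blast
  have "(\<lambda>\<omega>. \<lambda>i\<in>{1..n}. X i \<omega>) -` {v \<in> {1..n} \<rightarrow>\<^sub>E UNIV. P v} \<inter> space M \<in> events"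
    by (rule measurable_sets[OF m]) auto
  also have "(\<lambda>\<omega>. \<lambda>i\<in>{1..n}. X i \<omega>) -` {v \<in> {1..n} \<rightarrow>\<^sub>E UNIV. P v} \<inter> space M
      = {\<omega> \<in> space M. P (\<lambda>i\<in>{1..n}. X i \<omega>)}" by auto
  finally show ?thesis .
qed

lemma past_K_B_event:
  assumes n: "n \<ge> 1"
  shows "{\<omega> \<in> space M. P (\<lambda>i\<in>{1..n}. X i \<omega>) \<and> K n \<omega> = j \<and> B n \<omega> = b} \<in> events"
proof -
  \<comment> \<open>\<open>K n\<close> is measurable into \<open>count_space {1..n}\<close> only, so
    \<open>{j}\<close> is cut down to that range; since \<open>K n\<close> takes its values there,
    the event does not change.\<close>
  have "K n -` ({j} \<inter> {1..n}) \<inter> space M \<in> events"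
    by (rule measurable_sets[OF K_measurable[OF n]]) auto
  moreover have "B n -` {b} \<inter> space M \<in> events"
    by (rule measurable_sets[OF B_measurable[OF n]]) auto
  ultimately have "{\<omega> \<in> space M. P (\<lambda>i\<in>{1..n}. X i \<omega>)} \<inter> (K n -` ({j} \<inter> {1..n}) \<inter> space M)
      \<inter> (B n -` {b} \<inter> space M) \<in> events"
    using past_event[OF n, of P] by blast
  also have "{\<omega> \<in> space M. P (\<lambda>i\<in>{1..n}. X i \<omega>)} \<inter> (K n -` ({j} \<inter> {1..n}) \<inter> space M)
      \<inter> (B n -` {b} \<inter> space M)
      = {\<omega> \<in> space M. P (\<lambda>i\<in>{1..n}. X i \<omega>) \<and> K n \<omega> = j \<and> B n \<omega> = b}"
    using K_range[OF n] by auto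
  finally show ?thesis .
qed

text \<open>Split by the values \<open>j\<close> of \<open>K n\<close> and \<open>b\<close> of
  \<open>B n\<close>: the new step equals \<open>e\<close> exactly when step \<open>j\<close> was
  \<open>e\<close> and is repeated, or was \<open>- e\<close> and is reversed.\<close>

lemma prob_past_next:
  assumes n: "n \<ge> 1"
  shows "prob {\<omega> \<in> space M. P (\<lambda>i\<in>{1..n}. X i \<omega>) \<and> X (n + 1) \<omega> = e}
    = (p * (\<Sum>j=1..n. prob {\<omega> \<in> space M. P (\<lambda>i\<in>{1..n}. X i \<omega>) \<and> X j \<omega> = e})
      + (1 - p) * (\<Sum>j=1..n. prob {\<omega> \<in> space M. P (\<lambda>i\<in>{1..n}. X i \<omega>) \<and> X j \<omega> = - e})) / n"
proof -
  \<comment> \<open>\<open>Q j b\<close> moves the condition on the recalled step into the past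
    event, so that each of the disjoint cells \<open>F (j, b)\<close> has the shape handled by
    \<open>prob_past_K_B\<close>.\<close>
  define Q where "Q j b v \<longleftrightarrow> P v \<and> v j = (if b then e else - e)" for j b and v :: "nat \<Rightarrow> int"
  define F where "F = (\<lambda>(j, b). {\<omega> \<in> space M. Q j b (\<lambda>i\<in>{1..n}. X i \<omega>) \<and> K n \<omega> = j \<and> B n \<omega> = b})"
  have "{\<omega> \<in> space M. P (\<lambda>i\<in>{1..n}. X i \<omega>) \<and> X (n + 1) \<omega> = e} = (\<Union>x\<in>{1..n} \<times> UNIV. F x)"
    (is "?L = ?R")
  proof (rule set_eqI)
    fix \<omega>
    show "\<omega> \<in> ?L \<longleftrightarrow> \<omega> \<in> ?R"
    proof (cases "\<omega> \<in> space M")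
      case True
      then show ?thesis
        using K_range[OF n True] step[OF n True] by (auto simp: F_def Q_def)
    qed (auto simp: F_def)
  qed
  also have "prob (\<Union>x\<in>{1..n} \<times> UNIV. F x) = (\<Sum>x\<in>{1..n} \<times> UNIV. prob (F x))"
    by (rule finite_measure_finite_Union)
      (auto simp: F_def disjoint_family_on_def past_K_B_event[OF n] simp del: One_nat_def)
  also have "\<dots> = (\<Sum>j=1..n. \<Sum>b\<in>UNIV. prob (F (j, b)))"
    by (simp add: sum.cartesian_product)
  also have "\<dots> = (\<Sum>j=1..n. p * prob {\<omega> \<in> space M. P (\<lambda>i\<in>{1..n}. X i \<omega>) \<and> X j \<omega> = e} / n
      + (1 - p) * prob {\<omega> \<in> space M. P (\<lambda>i\<in>{1..n}. X i \<omega>) \<and> X j \<omega> = - e} / n)"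
  proof (rule sum.cong[OF refl])
    fix j assume j: "j \<in> {1..n}"
    have "prob (F (j, b)) = prob {\<omega> \<in> space M. P (\<lambda>i\<in>{1..n}. X i \<omega>)
        \<and> X j \<omega> = (if b then e else - e)} / n * (if b then p else 1 - p)" for b
      using prob_past_K_B[OF n j, of "Q j b" b] j unfolding F_def Q_def by simp
    then show "(\<Sum>b\<in>UNIV. prob (F (j, b)))
      = p * prob {\<omega> \<in> space M. P (\<lambda>i\<in>{1..n}. X i \<omega>) \<and> X j \<omega> = e} / n
      + (1 - p) * prob {\<omega> \<in> space M. P (\<lambda>i\<in>{1..n}. X i \<omega>) \<and> X j \<omega> = - e} / n"
      by (simp add: UNIV_bool mult.commute)
  qed
  also have "\<dots> = (p * (\<Sum>j=1..n. prob {\<omega> \<in> space M. P (\<lambda>i\<in>{1..n}. X i \<omega>) \<and> X j \<omega> = e})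
      + (1 - p) * (\<Sum>j=1..n. prob {\<omega> \<in> space M. P (\<lambda>i\<in>{1..n}. X i \<omega>) \<and> X j \<omega> = - e})) / n"
    by (simp add: sum.distrib sum_distrib_left sum_divide_distrib add_divide_distrib)
  finally show ?thesis .
qed

section \<open>Signs of the steps and the transition probabilities of the walk\<close>

lemma X_event: "n \<ge> 1 \<Longrightarrow> {\<omega> \<in> space M. X n \<omega> = x} \<in> events"
  using X_measurable by (rule measurable_sets_Collect[of _ _ _ "\<lambda>y. y = x"]) auto

text \<open>The two first-step probabilities \<open>q\<close> and \<open>1 - q\<close> add up to 1,
  which settles \<open>X 1\<close> up to a null set; every later step is an earlier one up to
  sign.\<close>

lemma AE_X_sign: "n \<ge> 1 \<Longrightarrow> AE \<omega> in M. \<forall>i\<in>{1..n}. X i \<omega> = 1 \<or> X i \<omega> = - 1"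
proof (induction n rule: dec_induct)
  case base
  have "{\<omega> \<in> space M. X 1 \<omega> = 1 \<or> X 1 \<omega> = - 1}
      = {\<omega> \<in> space M. X 1 \<omega> = 1} \<union> {\<omega> \<in> space M. X 1 \<omega> = - 1}" by auto
  also have "prob \<dots> = 1"
    using first_step_pos first_step_neg by (subst finite_measure_Union) (auto intro: X_event)
  finally have "AE \<omega> in M. X 1 \<omega> = 1 \<or> X 1 \<omega> = - 1"
    by (rule prob_Collect_eq_1[THEN iffD1, rotated]) (use X_event[of 1] in auto)
  then show ?case by simp
next
  case (step n)
  show ?case
    using step.IH AE_space
  proof eventually_elim
    case (elim \<omega>)
    have "K n \<omega> \<in> {1..n}" using K_range step.hyps elim by auto
    then have "X (Suc n) \<omega> = 1 \<or> X (Suc n) \<omega> = - 1"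
      using elim elephant_random_walk.step[OF elephant_random_walk_axioms step.hyps(1), of \<omega>] by auto
    then show ?case using elim by (auto simp: le_Suc_eq)
  qed
qed

lemma S_eq_sum: "\<omega> \<in> space M \<Longrightarrow> S n \<omega> = (\<Sum>i=1..n. X i \<omega>)"
  using S_Suc by (induction n) (auto simp: S_0)

text \<open>This exhibits \<open>S n\<close> as a function of the restricted past vector, the form
  in which \<open>past_event\<close> and \<open>prob_past_next\<close> apply to it.\<close>

lemma S_eq_sum_past: "\<omega> \<in> space M \<Longrightarrow> S n \<omega> = (\<Sum>i=1..n. (\<lambda>i\<in>{1..n}. X i \<omega>) i)"
  by (simp add: S_eq_sum)

lemma S_event:
  assumes "n \<ge> 1"
  shows "{\<omega> \<in> space M. S n \<omega> = s} \<in> events"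
proof -
  have "{\<omega> \<in> space M. S n \<omega> = s} = {\<omega> \<in> space M. (\<Sum>i=1..n. (\<lambda>i\<in>{1..n}. X i \<omega>) i) = s}"
    using S_eq_sum_past by metis
  then show ?thesis
    using past_event[OF assms, of "\<lambda>v. (\<Sum>i=1..n. v i) = s"] by (simp only:)
qed

lemma S_X_event:
  assumes "n \<ge> 1" "m \<ge> 1"
  shows "{\<omega> \<in> space M. S n \<omega> = s \<and> X m \<omega> = e} \<in> events"
proof -
  have "{\<omega> \<in> space M. S n \<omega> = s \<and> X m \<omega> = e} = {\<omega> \<in> space M. S n \<omega> = s} \<inter> {\<omega> \<in> space M. X m \<omega> = e}"
    by auto
  also have "\<dots> \<in> events" using assms by (intro sets.Int S_event X_event)
  finally show ?thesis .
qed

text \<open>The sum is the expected number of steps equal to \<open>e\<close> on the event that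
  \<open>S n\<close> is \<open>s\<close>. On that event the number is almost surely the constant
  \<open>(n + e * s) / 2\<close>.\<close>

lemma sum_prob_S_X:
  assumes n: "n \<ge> 1" and e: "e = 1 \<or> e = - 1"
  shows "(\<Sum>j=1..n. prob {\<omega> \<in> space M. S n \<omega> = s \<and> X j \<omega> = e})
    = (real n + e * s) / 2 * prob {\<omega> \<in> space M. S n \<omega> = s}"
proof -
  have ev: "{\<omega> \<in> space M. S n \<omega> = s \<and> X j \<omega> = e} \<in> events" if "j \<in> {1..n}" for j
    using S_X_event n that by auto
  have "(\<Sum>j=1..n. prob {\<omega> \<in> space M. S n \<omega> = s \<and> X j \<omega> = e})
      = (\<Sum>j=1..n. expectation (indicator {\<omega> \<in> space M. S n \<omega> = s \<and> X j \<omega> = e}))"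
    using ev by (intro sum.cong) auto
  also have "\<dots> = expectation (\<lambda>\<omega>. \<Sum>j=1..n. indicator {\<omega> \<in> space M. S n \<omega> = s \<and> X j \<omega> = e} \<omega>)"
    using ev by (subst Bochner_Integration.integral_sum)
      (auto intro!: integrable_real_indicator simp: emeasure_eq_measure)
  also have "\<dots> = expectation (\<lambda>\<omega>. (real n + e * s) / 2 * indicator {\<omega> \<in> space M. S n \<omega> = s} \<omega>)"
  proof (rule integral_cong_AE)
    show "AE \<omega> in M. (\<Sum>j=1..n. indicator {\<omega> \<in> space M. S n \<omega> = s \<and> X j \<omega> = e} \<omega>)
        = (real n + e * s) / 2 * indicator {\<omega> \<in> space M. S n \<omega> = s} \<omega>"
      using AE_X_sign[OF n] AE_space
    proof eventually_elim
      case (elim \<omega>)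
      show ?case
      proof (cases "S n \<omega> = s")
        case True
        \<comment> \<open>For signs \<open>e\<close> and \<open>X j\<close>, the indicator of their
          equality is \<open>(1 + e * X j) / 2\<close>, which is linear in \<open>X j\<close> and so
          sums to an expression in \<open>S n\<close>.\<close>
        have "(\<Sum>j=1..n. indicator {\<omega> \<in> space M. S n \<omega> = s \<and> X j \<omega> = e} \<omega>)
            = (\<Sum>j=1..n. (1 + real_of_int e * real_of_int (X j \<omega>)) / 2)"
          using elim e True by (intro sum.cong) (auto simp: indicator_def)
        also have "\<dots> = (real n + e * s) / 2"
          using True S_eq_sum[of \<omega> n] elim
          by (simp add: sum.distrib flip: sum_divide_distrib sum_distrib_left of_int_sum)
        finally show ?thesis using True elim by simp
      qed simp
    qed
  qed (use ev S_event[OF n] in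
      \<open>auto intro!: borel_measurable_sum borel_measurable_indicator borel_measurable_times\<close>)
  also have "\<dots> = (real n + e * s) / 2 * prob {\<omega> \<in> space M. S n \<omega> = s}"
    using S_event[OF n] by simp
  finally show ?thesis .
qed

text \<open>With the event about \<open>S n\<close> as past, the two counts enter with weights
  \<open>p\<close> and \<open>1 - p\<close>; the terms in \<open>e * s\<close> then combine to the
  factor \<open>2 * p - 1\<close>.\<close>

lemma prob_S_next:
  assumes n: "n \<ge> 1" and e: "e = 1 \<or> e = - 1"
  shows "prob {\<omega> \<in> space M. S n \<omega> = s \<and> X (n + 1) \<omega> = e}
    = (1 + (2 * p - 1) * e * s / n) / 2 * prob {\<omega> \<in> space M. S n \<omega> = s}"
proof -
  have S: "{\<omega> \<in> space M. S n \<omega> = s \<and> R \<omega>}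
      = {\<omega> \<in> space M. (\<Sum>i=1..n. (\<lambda>i\<in>{1..n}. X i \<omega>) i) = s \<and> R \<omega>}" for R
    using S_eq_sum_past by metis
  have "prob {\<omega> \<in> space M. S n \<omega> = s \<and> X (n + 1) \<omega> = e}
    = (p * (\<Sum>j=1..n. prob {\<omega> \<in> space M. S n \<omega> = s \<and> X j \<omega> = e})
      + (1 - p) * (\<Sum>j=1..n. prob {\<omega> \<in> space M. S n \<omega> = s \<and> X j \<omega> = - e})) / n"
    unfolding S by (rule prob_past_next[OF n])
  also have "\<dots> = (p * ((real n + e * s) / 2 * prob {\<omega> \<in> space M. S n \<omega> = s})
      + (1 - p) * ((real n - e * s) / 2 * prob {\<omega> \<in> space M. S n \<omega> = s})) / n"
    using sum_prob_S_X[OF n e, of s] sum_prob_S_X[OF n, of "- e" s] e by (simp only: of_int_minus) auto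
  also have "\<dots> = (1 + (2 * p - 1) * e * s / n) / 2 * prob {\<omega> \<in> space M. S n \<omega> = s}"
    using n by (simp add: field_simps)
  finally show ?thesis .
qed

lemma prob_S_Suc:
  assumes n: "n \<ge> 1"
  shows "prob {\<omega> \<in> space M. S (Suc n) \<omega> = k}
    = (1 + (2 * p - 1) * (k - 1) / n) / 2 * prob {\<omega> \<in> space M. S n \<omega> = k - 1}
    + (1 - (2 * p - 1) * (k + 1) / n) / 2 * prob {\<omega> \<in> space M. S n \<omega> = k + 1}"
proof -
  let ?U = "\<lambda>e. {\<omega> \<in> space M. S n \<omega> = k - e \<and> X (n + 1) \<omega> = e}"
  have U: "?U e \<in> events" for e using n by (intro S_X_event) auto
  \<comment> \<open>The two events agree only almost surely, because steps other than 1 and -1 are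
    excluded only up to a null set.\<close>
  have "prob {\<omega> \<in> space M. S (Suc n) \<omega> = k} = prob (?U 1 \<union> ?U (- 1))"
  proof (rule finite_measure_eq_AE)
    show "AE \<omega> in M. \<omega> \<in> {\<omega> \<in> space M. S (Suc n) \<omega> = k} \<longleftrightarrow> \<omega> \<in> ?U 1 \<union> ?U (- 1)"
      using AE_X_sign[OF le_add2, of n] AE_space
    proof eventually_elim
      case (elim \<omega>)
      have "X (n + 1) \<omega> = 1 \<or> X (n + 1) \<omega> = - 1" using elim n by auto
      then show ?case using elim(2) S_Suc[of \<omega> n] by auto
    qed
  next
    show "{\<omega> \<in> space M. S (Suc n) \<omega> = k} \<in> events" by (rule S_event) simp
    show "?U 1 \<union> ?U (- 1) \<in> events" by (intro sets.Un U)
  qed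
  also have "\<dots> = prob (?U 1) + prob (?U (- 1))"
    by (intro finite_measure_Union U) auto
  also have "prob (?U 1) = (1 + (2 * p - 1) * (k - 1) / n) / 2 * prob {\<omega> \<in> space M. S n \<omega> = k - 1}"
    using prob_S_next[OF n, of 1 "k - 1"] by simp
  also have "prob (?U (- 1)) = (1 - (2 * p - 1) * (k + 1) / n) / 2 * prob {\<omega> \<in> space M. S n \<omega> = k + 1}"
    using prob_S_next[OF n, of "- 1" "k + 1"] by (simp del: minus_diff_eq)
  finally show ?thesis .
qed

end

section \<open>Binomial coefficients with an integer lower index\<close>

text \<open>The value 0 at negative \<open>k\<close> lets Pascal's rule and the absorption identity
  hold for all integers, without boundary cases at the ends of the range of the walk.\<close>

definition ibinomial :: "nat \<Rightarrow> int \<Rightarrow> real" where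
  "ibinomial n k = (if k < 0 then 0 else real (n choose nat k))"

lemma ibinomial_Suc: "ibinomial (Suc n) k = ibinomial n k + ibinomial n (k - 1)"
proof (cases "k \<ge> 1")
  case True
  then obtain m where "k = int (Suc m)" using that[of "nat (k - 1)"] by simp
  then show ?thesis by (simp add: ibinomial_def nat_add_distrib)
next
  case False
  then show ?thesis by (cases "k = 0") (auto simp: ibinomial_def)
qed

text \<open>For \<open>k \<ge> 0\<close> both sides equal \<open>n * ((n - 1) choose k)\<close>; at
  \<open>k = -1\<close> the right factor \<open>k + 1\<close> vanishes.\<close>

lemma ibinomial_absorb: "(n - k) * ibinomial n k = (k + 1) * ibinomial n (k + 1)"
  for n :: nat and k :: int
proof (cases "k \<ge> 0")
  case True
  then obtain m where k: "k = int m" by (metis nat_0_le)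
  have "real (n - m) * real (n choose m) = real (Suc m) * real (n choose Suc m)"
    by (metis binomial_absorb_comp binomial_absorption of_nat_mult)
  \<comment> \<open>Truncated subtraction differs from the real one only for \<open>m > n\<close>,
    where the binomial coefficient is 0.\<close>
  moreover have "(real n - real m) * real (n choose m) = real (n - m) * real (n choose m)"
    by (cases "m \<le> n") (auto simp: of_nat_diff binomial_eq_0)
  ultimately show ?thesis by (simp add: ibinomial_def k nat_add_distrib algebra_simps)
next
  case False
  then show ?thesis by (cases "k = -1") (auto simp: ibinomial_def)
qed

text \<open>Pascal's rule applied twice turns the right side into
  \<open>n * (a + 2 * b + c)\<close>. After cancelling \<open>n * a\<close> and
  \<open>n * c\<close>, absorption turns the remaining left side into
  \<open>(n + k) * b + (n - k) * b\<close>, which is \<open>2 * n * b\<close>.\<close>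

lemma ibinomial_recursion:
  "(2 * real n - k + 1) * ibinomial (2 * n) (n + k - 1)
     + (2 * real n + k + 1) * ibinomial (2 * n) (n + k + 1)
   = n * ibinomial (2 * Suc n) (Suc n + k)" for n :: nat and k :: int
proof -
  define a b c where "a = ibinomial (2 * n) (n + k - 1)" and "b = ibinomial (2 * n) (n + k)"
    and "c = ibinomial (2 * n) (n + k + 1)"
  have "ibinomial (2 * Suc n) (Suc n + k) = a + 2 * b + c"
    by (simp add: ibinomial_Suc a_def b_def c_def algebra_simps)
  moreover have "(real n - k + 1) * a = (real n + k) * b"
    using ibinomial_absorb[of "2 * n" "n + k - 1"] by (simp add: a_def b_def algebra_simps)
  moreover have "(real n - k) * b = (real n + k + 1) * c"
    using ibinomial_absorb[of "2 * n" "n + k"] by (simp add: b_def c_def algebra_simps)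
  ultimately show ?thesis
    unfolding a_def[symmetric] c_def[symmetric] by (simp add: algebra_simps)
qed

section \<open>Exact law of the walk for q = 1/2 and p = 1/4\<close>

text \<open>Induction on \<open>n\<close> through \<open>prob_S_Suc\<close>. The claim covers all
  integers \<open>k\<close> of the right parity, both sides being 0 for \<open>|k| > n\<close>, so
  the recursion may look beyond the range of the walk.\<close>

lemma (in elephant_random_walk) prob_S_quarter:
  assumes q: "q = 1/2" and p: "p = 1/4" and "n \<ge> 1" "even k \<longleftrightarrow> even n"
  shows "prob {\<omega> \<in> space M. S n \<omega> = k} = 2 / 4 ^ n * ibinomial (2 * n) (n + k)"
  using assms(3,4)
proof (induction n arbitrary: k rule: dec_induct)
  case base
  have "{\<omega> \<in> space M. S 1 \<omega> = k} = {\<omega> \<in> space M. X 1 \<omega> = k}"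
    using S_eq_sum by fastforce
  moreover have "prob {\<omega> \<in> space M. X 1 \<omega> = k} = 0" if "k \<noteq> 1" "k \<noteq> - 1"
    by (rule prob_eq_0_AE) (use AE_X_sign[of 1] that in \<open>auto elim: eventually_mono\<close>)
  \<comment> \<open>Parity matters here: at \<open>k = 0\<close> the formula would give 1, whereas
    the walk is almost surely at 1 or -1.\<close>
  moreover have "k \<noteq> 0" using base by auto
  then consider "k = 1" | "k = - 1" | "k < - 1" | "k > 1" by linarith
  then have "2 / 4 * ibinomial 2 (1 + k) = (if k = 1 \<or> k = - 1 then 1 / 2 else 0)"
    by cases (auto simp: ibinomial_def intro!: binomial_eq_0)
  ultimately show ?case using first_step_pos first_step_neg q by auto
next
  case (step n)
  have "prob {\<omega> \<in> space M. S (Suc n) \<omega> = k}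
    = (1 - (k - 1) / (2 * n)) / 2 * (2 / 4 ^ n * ibinomial (2 * n) (n + (k - 1)))
      + (1 + (k + 1) / (2 * n)) / 2 * (2 / 4 ^ n * ibinomial (2 * n) (n + (k + 1)))"
    using step by (subst prob_S_Suc) (auto simp: p)
  \<comment> \<open>Since \<open>2 * p - 1 = -1/2\<close>, the transition factors are
    \<open>(2 * n - k + 1) / (4 * n)\<close> and \<open>(2 * n + k + 1) / (4 * n)\<close>; this
    produces the left side of \<open>ibinomial_recursion\<close>.\<close>
  also have "\<dots> = 2 / 4 ^ Suc n / n * ((2 * real n - k + 1) * ibinomial (2 * n) (n + k - 1)
     + (2 * real n + k + 1) * ibinomial (2 * n) (n + k + 1))"
    using step.hyps by (simp add: field_simps)
  also have "\<dots> = 2 / 4 ^ Suc n * ibinomial (2 * Suc n) (Suc n + k)"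
    unfolding ibinomial_recursion using step.hyps by simp
  finally show ?case .
qed

section \<open>Asymptotics of the central binomial coefficient\<close>

lemma central_binomial_limit:
  "(\<lambda>n. real (2 * n choose n) / 4 ^ n * sqrt n) \<longlonglongrightarrow> 1 / sqrt pi"
proof -
  have binom: "real (2 * n choose n) / 4 ^ n = pochhammer (1/2) n / fact n" for n :: nat
  proof -
    have "real (2 * n choose n) = fact (2 * n) / (fact n * fact n)"
      using binomial_fact[of n "2 * n", where 'a = real] by simp
    then show ?thesis by (simp add: fact_double power_mult)
  qed
  \<comment> \<open>The Gauss product has \<open>pochhammer (1/2) (n + 1)\<close> in its
    denominator. The correction \<open>1 + 1 / (2 * n) = (1/2 + n) / n\<close> tends to 1 and
    cancels the surplus factor \<open>1/2 + n\<close>.\<close>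
  have "(\<lambda>n. inverse (Gamma_series (1/2) n * (1 + 1 / (2 * real n)))) \<longlonglongrightarrow> inverse (sqrt pi * (1 + 0))"
    unfolding Gamma_one_half_real[symmetric]
    by (intro tendsto_intros) (real_asymp | simp add: Gamma_one_half_real)+
  then have "(\<lambda>n. inverse (Gamma_series (1/2) n * (1 + 1 / (2 * real n)))) \<longlonglongrightarrow> 1 / sqrt pi"
    by (simp add: field_simps)
  moreover have "\<forall>\<^sub>F n in sequentially. inverse (Gamma_series (1/2) n * (1 + 1 / (2 * real n)))
      = real (2 * n choose n) / 4 ^ n * sqrt n"
    using eventually_gt_at_top[of 0]
  proof eventually_elim
    case (elim n)
    have "exp (ln (real n) / 2) = sqrt n"
      using elim powr_half_sqrt[of "real n"] by (simp add: powr_def)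
    then have *: "Gamma_series (1/2) n = fact n * sqrt n / (pochhammer (1/2) n * (1/2 + n))"
      by (simp add: Gamma_series_def pochhammer_Suc)
    have "pochhammer (1/2 :: real) n > 0" by (rule pochhammer_pos) simp
    moreover have "fact n * sqrt n / (x * (1/2 + n)) * (1 + 1 / (2 * real n)) = fact n / (x * sqrt n)"
      if "x > 0" for x :: real
    proof -
      \<comment> \<open>Here \<open>n\<close> is written as \<open>sqrt n * sqrt n\<close>, so that
        one root cancels.\<close>
      have "fact n * sqrt n / (x * (1/2 + n)) * ((1/2 + n) / (sqrt n * sqrt n)) = fact n / (x * sqrt n)"
        using elim that by (simp add: divide_simps)
      then show ?thesis using elim by (simp add: field_simps)
    qed
    ultimately show ?case
      unfolding binom * by simp
  qed
  ultimately show ?thesis by (rule Lim_transform_eventually)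
qed

section \<open>The closed-form law and the decay of the return probability\<close>

theorem proposition7:
  fixes M :: "'a measure" and X :: "nat \<Rightarrow> 'a \<Rightarrow> int" and K :: "nat \<Rightarrow> 'a \<Rightarrow> nat"
    and B :: "nat \<Rightarrow> 'a \<Rightarrow> bool" and S :: "nat \<Rightarrow> 'a \<Rightarrow> int"
  assumes "elephant_random_walk M (1/2) (1/4) X K B S"
  shows "(\<forall>(n::nat) (k::int). n \<ge> 1 \<longrightarrow> - int n \<le> k \<longrightarrow> k \<le> int n \<longrightarrow> (even k \<longleftrightarrow> even n) \<longrightarrow>
            measure M {\<omega> \<in> space M. S n \<omega> = k}
              = 1 / 2 ^ (2 * n - 1) * real ((2 * n) choose nat (int n + k)))
       \<and> (\<forall>n::nat. n \<ge> 1 \<longrightarrow>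
            measure M {\<omega> \<in> space M. S (2 * n) \<omega> = 0}
              = 1 / 2 ^ (4 * n - 1) * real ((4 * n) choose (2 * n)))
       \<and> (\<lambda>n::nat. measure M {\<omega> \<in> space M. S (2 * n) \<omega> = 0})
            \<sim>[at_top] (\<lambda>n. sqrt (2 / (pi * real n)))"
proof -
  interpret elephant_random_walk M "1/2" "1/4" X K B S by fact
  have law: "measure M {\<omega> \<in> space M. S n \<omega> = k} = 2 / 4 ^ n * real ((2 * n) choose nat (int n + k))"
    if "n \<ge> 1" "- int n \<le> k" "even k \<longleftrightarrow> even n" for n k
    using prob_S_quarter[of n k] that by (simp add: ibinomial_def)
  have pow: "2 / 4 ^ n = (1 / 2 ^ (2 * n - 1) :: real)" if "n \<ge> 1" for n :: nat
    using that by (cases n) (simp_all add: power_mult)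
  have zero: "measure M {\<omega> \<in> space M. S (2 * n) \<omega> = 0}
      = 2 / 4 ^ (2 * n) * real ((4 * n) choose (2 * n))" if "n \<ge> 1" for n
    using law[of "2 * n" 0] that by (simp add: nat_mult_distrib)
  \<comment> \<open>The central binomial limit along even indices, rescaled by
    \<open>sqrt pi\<close> so that the limit is 1; these terms are the ratio of the return
    probability to \<open>sqrt (2 / (pi * n))\<close>.\<close>
  have "(\<lambda>n. sqrt pi * (real (2 * (2 * n) choose (2 * n)) / 4 ^ (2 * n) * sqrt (2 * n)))
      \<longlonglongrightarrow> sqrt pi * (1 / sqrt pi)"
    by (intro tendsto_mult tendsto_const
        filterlim_compose[OF central_binomial_limit, of "\<lambda>n. 2 * n"]) real_asymp
  then have lim: "(\<lambda>n. sqrt pi * (real (2 * (2 * n) choose (2 * n)) / 4 ^ (2 * n) * sqrt (2 * n)))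
      \<longlonglongrightarrow> 1" by simp
  have "(\<lambda>n. measure M {\<omega> \<in> space M. S (2 * n) \<omega> = 0}) \<sim>[at_top] (\<lambda>n. sqrt (2 / (pi * real n)))"
  proof (rule asymp_equivI'[OF Lim_transform_eventually[OF lim]])
    show "\<forall>\<^sub>F n in sequentially.
        sqrt pi * (real (2 * (2 * n) choose (2 * n)) / 4 ^ (2 * n) * sqrt (2 * n))
        = measure M {\<omega> \<in> space M. S (2 * n) \<omega> = 0} / sqrt (2 / (pi * real n))"
      using eventually_ge_at_top[of 1]
    proof eventually_elim
      case (elim n)
      have *: "2 / sqrt (2 / (pi * real n)) = sqrt pi * sqrt (2 * n)"
        using elim by (simp add: real_sqrt_divide real_sqrt_mult field_simps)
      then have "measure M {\<omega> \<in> space M. S (2 * n) \<omega> = 0} / sqrt (2 / (pi * real n))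
          = sqrt pi * sqrt (2 * n) * (real (4 * n choose (2 * n)) / 4 ^ (2 * n))"
        unfolding zero[OF elim] *[symmetric] by simp
      then show ?case by (simp add: mult_ac)
    qed
  qed
  moreover have "measure M {\<omega> \<in> space M. S (2 * n) \<omega> = 0}
      = 1 / 2 ^ (4 * n - 1) * real ((4 * n) choose (2 * n))" if "n \<ge> 1" for n
    using zero[OF that] pow[of "2 * n"] that by simp
  ultimately show ?thesis using law pow by simp
qed

end
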